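(* Let $\beta_1\neq\beta_2$ with $\beta_1,\beta_2>1/2$, suppose that $\beta\in\{\beta_1,\beta_2\}$, and fix $Q\in(0,\infty)$. Let $J=J(n)$ be integers with $2^J\asymp n$. Then there exists no data-driven procedure $t_j=t_j((Y_{j,k})_{j,k})$, $-1\le j\le J$, which is independent of $\beta$ (i.e. $t_j$ is a function of the empirical wavelet coefficients that does not depend on which of $\beta_1,\beta_2$ is the true smoothness) and which satisfies, for some finite constant $Q'$ and as $n\to\infty$, $$\inf_{f\in\Theta(\beta_i,Q)}\mathbb{P}_f\Big(Q2^{-\frac j2(2\beta_i+1)}\le t_j\le Q'2^{-\frac j2(2\beta_i+1)}\ \text{ for all } j\le J\Big)\longrightarrow 1,\qquad i=1,2.$$
   Context: Model: one observes $(Y_t)_{t\in[0,1]}$ with $dY_t=f(t)\,dt+n^{-1/2}dW_t$, $W$ a Brownian motion; $\mathbb{P}_f$ denotes probability under regression function $f$. Wavelets: $(\phi,\psi)$ is a scaling and wavelet function generating an orthonormal wavelet basis $\{\psi_{j,k}: j\ge -1,\ k\in I_j\}$ of $L^2[0,1]$, where $\psi_{-1,k}=\phi(\cdot-k)$ and $\psi_{j,k}=2^{j/2}\psi(2^j\cdot-k)$ for $j\ge 0$ (near the endpoints of $[0,1]$ one uses the boundary-adapted functions of the Cohen–Daubechies–Vial construction). The basis is $s$-regular: $\phi,\psi$ have compact support and are $s$-times continuously differentiable. $I_j$ is the finite set of indices on resolution level $j$, and $|I_j|\asymp 2^j$. For $f\in L^2[0,1]$, $d_{j,k}=\int f\psi_{j,k}$.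 The empirical wavelet coefficients are $Y_{j,k}=\int\psi_{j,k}(u)\,dY_u=d_{j,k}+n^{-1/2}\epsilon_{j,k}$, with $(\epsilon_{j,k})$ i.i.d. standard normal. Parameter space: $\Theta(\beta,Q)=\{f=\sum_{j=-1}^\infty\sum_{k\in I_j}d_{j,k}\psi_{j,k}:\ |d_{j,k}|\le Q2^{-\frac j2(2\beta+1)}\ \text{for all } j\ge-1,\ k\in I_j\}$. $a_n\asymp b_n$ means $a_n/b_n$ is bounded above and below by positive constants. *)

theory Defs
  imports "HOL-Probability.Probability" "HOL-Library.Landau_Symbols"
begin

section \<open>The space of square integrable functions on the unit interval\<close>

definition L2_unit :: "(real \<Rightarrow> real) set" where
  "L2_unit = {f. f \<in> borel_measurable (lebesgue_on {0..1})
                 \<and> integrable (lebesgue_on {0..1}) (\<lambda>x. (f x)\<^sup>2)}"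

definition inner_unit :: "(real \<Rightarrow> real) \<Rightarrow> (real \<Rightarrow> real) \<Rightarrow> real" where
  "inner_unit f g = (\<integral>x. f x * g x \<partial>lebesgue_on {0..1})"

text \<open>Linear span of functions restricted to the unit interval; values elsewhere are irrelevant.\<close>

definition span_unit :: "(real \<Rightarrow> real) set \<Rightarrow> (real \<Rightarrow> real) set" where
  "span_unit S = {g. \<exists>F c. finite F \<and> F \<subseteq> S \<and> (\<forall>x\<in>{0..1}. g x = (\<Sum>f\<in>F. c f * f x))}"


section \<open>Compactly supported scaling and wavelet functions on the line\<close>

definition times_cont_diff :: "nat \<Rightarrow> (real \<Rightarrow> real) \<Rightarrow> bool" where
  "times_cont_diff s f \<longleftrightarrow> (\<exists>D. D 0 = f
     \<and> (\<forall>i<s. \<forall>x. (D i has_real_derivative D (Suc i) x) (at x))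
     \<and> continuous_on UNIV (D s))"

text \<open>
  An orthonormal scaling function \<open>\<phi>\<close> with wavelet \<open>\<psi>\<close>, both \<open>s\<close> times continuously
  differentiable, supported in \<open>[-L + 1, L]\<close>, where \<open>\<psi>\<close> has \<open>N\<close> vanishing moments.
  Daubechies wavelets with \<open>N\<close> vanishing moments have \<open>L = N\<close>; an arbitrary compact
  support is covered by taking \<open>L\<close> large.
\<close>

definition scaling_wavelet_pair ::
  "nat \<Rightarrow> nat \<Rightarrow> nat \<Rightarrow> (real \<Rightarrow> real) \<Rightarrow> (real \<Rightarrow> real) \<Rightarrow> bool" where
  "scaling_wavelet_pair s L N \<phi> \<psi> \<longleftrightarrow>
     times_cont_diff s \<phi> \<and> times_cont_diff s \<psi>
   \<and> (\<forall>x. x \<notin> {1 - real L..real L} \<longrightarrow> \<phi> x = 0 \<and> \<psi> x = 0)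
   \<and> (\<integral>x. \<phi> x \<partial>lborel) = 1
   \<and> (\<forall>k::int. (\<integral>x. \<phi> x * \<phi> (x - of_int k) \<partial>lborel) = of_bool (k = 0)
              \<and> (\<integral>x. \<psi> x * \<psi> (x - of_int k) \<partial>lborel) = of_bool (k = 0)
              \<and> (\<integral>x. \<phi> x * \<psi> (x - of_int k) \<partial>lborel) = 0)
   \<and> (\<exists>h g. \<forall>x.
         \<phi> x = sqrt 2 * (\<Sum>m\<in>{1 - int L..int L}. h m * \<phi> (2 * x - of_int m))
       \<and> \<psi> x = sqrt 2 * (\<Sum>m\<in>{1 - int L..int L}. g m * \<phi> (2 * x - of_int m)))
   \<and> (\<forall>l<N. (\<integral>x. x ^ l * \<psi> x \<partial>lborel) = 0)"

definition wavelet_fun ::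
  "(real \<Rightarrow> real) \<Rightarrow> (real \<Rightarrow> real) \<Rightarrow> int \<Rightarrow> int \<Rightarrow> real \<Rightarrow> real" where
  "wavelet_fun \<phi> \<psi> j k x =
     (if j = -1 then \<phi> (x - of_int k)
      else 2 powr (of_int j / 2) * \<psi> (2 powr of_int j * x - of_int k))"


section \<open>Boundary-adapted wavelet bases of Cohen, Daubechies and Vial\<close>

text \<open>
  The positions \<open>k\<close> at resolution \<open>j\<close> for which \<open>2 ^ j * x - k\<close> carries \<open>[-L + 1, L]\<close>
  into the open unit interval. For \<open>j = -1\<close> the translates have integer shifts, as for \<open>j = 0\<close>.
\<close>

definition interior_positions :: "nat \<Rightarrow> int \<Rightarrow> int set" where
  "interior_positions L j = {int L..2 ^ nat j - int L - 1}"

text \<open>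
  The scaling space on the unit interval: interior scaling functions together with, at either
  endpoint, \<open>N\<close> edge functions, namely the combinations of the non-interior translates with
  coefficients polynomial in the position of degree less than \<open>N\<close>. The powers of \<open>m\<close> used here
  and the binomial coefficients of the original construction span the same polynomials.
\<close>

definition cdv_scaling_space :: "nat \<Rightarrow> nat \<Rightarrow> (real \<Rightarrow> real) \<Rightarrow> nat \<Rightarrow> (real \<Rightarrow> real) set" where
  "cdv_scaling_space L N \<phi> j = span_unit
     ({\<lambda>x. \<phi> (2 ^ j * x - of_int m) | m. m \<in> interior_positions L (int j)}
    \<union> {\<lambda>x. \<Sum>m\<in>{1 - int L..int L - 1}. of_int m ^ l * \<phi> (2 ^ j * x - of_int m) | l. l < N}
    \<union> {\<lambda>x. \<Sum>m\<in>{2 ^ j - int L..2 ^ j + int L - 2}.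
              of_int m ^ l * \<phi> (2 ^ j * x - of_int m) | l. l < N})"

text \<open>A level-wise expansion converging in the mean-square sense on the unit interval.\<close>

definition has_wavelet_expansion ::
  "(int \<Rightarrow> int set) \<Rightarrow> (int \<Rightarrow> int \<Rightarrow> real \<Rightarrow> real) \<Rightarrow> (real \<Rightarrow> real) \<Rightarrow> (int \<Rightarrow> int \<Rightarrow> real) \<Rightarrow> bool"
where
  "has_wavelet_expansion I \<Psi> f d \<longleftrightarrow>
     (\<lambda>m::nat. \<integral>x. (f x - (\<Sum>j\<in>{-1..int m}. \<Sum>k\<in>I j. d j k * \<Psi> j k x))\<^sup>2 \<partial>lebesgue_on {0..1})
       \<longlonglongrightarrow> 0"

definition wavelet_index :: "(int \<Rightarrow> int set) \<Rightarrow> (int \<times> int) set" where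
  "wavelet_index I = {(j, k). -1 \<le> j \<and> k \<in> I j}"

definition wavelet_coeff :: "(int \<Rightarrow> int \<Rightarrow> real \<Rightarrow> real) \<Rightarrow> (real \<Rightarrow> real) \<Rightarrow> int \<Rightarrow> int \<Rightarrow> real" where
  "wavelet_coeff \<Psi> f j k = inner_unit f (\<Psi> j k)"

definition orthonormal_basis_unit ::
  "(int \<Rightarrow> int set) \<Rightarrow> (int \<Rightarrow> int \<Rightarrow> real \<Rightarrow> real) \<Rightarrow> bool" where
  "orthonormal_basis_unit I \<Psi> \<longleftrightarrow>
     (\<forall>j\<ge>-1. finite (I j))
   \<and> (\<forall>(j, k)\<in>wavelet_index I. \<Psi> j k \<in> L2_unit)
   \<and> (\<forall>(j, k)\<in>wavelet_index I. \<forall>(j', k')\<in>wavelet_index I.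
        inner_unit (\<Psi> j k) (\<Psi> j' k') = of_bool ((j, k) = (j', k')))
   \<and> (\<forall>f\<in>L2_unit. has_wavelet_expansion I \<Psi> f (wavelet_coeff \<Psi> f))"

text \<open>
  From the level \<open>j0\<close> on, where the two endpoints no longer interact, there are \<open>2 ^ j\<close>
  wavelets: the interior ones, and \<open>L\<close> rescaled copies of fixed edge wavelets at either endpoint.
  The finitely many functions on the levels below \<open>j0\<close> (including level \<open>-1\<close>) are
  boundary-adapted and form an orthonormal basis of the scaling space of level \<open>j0\<close>.
  A continuous orthonormal scaling function is never supported in an interval of length one, so
  on level \<open>-1\<close> no integer translate fits and every function is boundary-adapted. The growth
  condition on the number of positions follows from the other ones and is stated for readability.
\<close>

definition cdv_wavelet_basis ::
  "nat \<Rightarrow> (real \<Rightarrow> real) \<Rightarrow> (real \<Rightarrow> real)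
     \<Rightarrow> (int \<Rightarrow> int set) \<Rightarrow> (int \<Rightarrow> int \<Rightarrow> real \<Rightarrow> real) \<Rightarrow> bool" where
  "cdv_wavelet_basis s \<phi> \<psi> I \<Psi> \<longleftrightarrow>
     orthonormal_basis_unit I \<Psi>
   \<and> (\<lambda>j. real (card (I (int j)))) \<in> \<Theta>(\<lambda>j. 2 ^ j)
   \<and> (\<exists>L N j0 left right K.
        1 \<le> N \<and> 1 \<le> L \<and> 2 * L \<le> 2 ^ j0
      \<and> scaling_wavelet_pair s L N \<phi> \<psi>
      \<and> (\<forall>j\<ge>-1. \<forall>k\<in>I j \<inter> interior_positions L j. \<forall>x\<in>{0..1}.
           \<Psi> j k x = wavelet_fun \<phi> \<psi> j k x)
      \<and> (\<forall>j\<ge>j0. I (int j) = {0..<2 ^ j})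
      \<and> (\<forall>j\<ge>j0. \<forall>k\<in>{0..<L}. \<forall>x\<in>{0..1}.
           \<Psi> (int j) (int k) x = 2 powr (real j / 2) * left k (2 ^ j * x)
         \<and> \<Psi> (int j) (2 ^ j - 1 - int k) x = 2 powr (real j / 2) * right k (2 ^ j * (1 - x)))
      \<and> (\<forall>k\<in>{0..<L}. \<forall>x>K. left k x = (0::real) \<and> right k x = (0::real))
      \<and> (\<forall>j\<ge>j0. span_unit {\<Psi> i k | i k. (i, k) \<in> wavelet_index I \<and> i < int j}
                 = cdv_scaling_space L N \<phi> j))"


section \<open>The parameter space\<close>

definition coeff_bound :: "real \<Rightarrow> int \<Rightarrow> real" where
  "coeff_bound \<beta> j = 2 powr (- (of_int j / 2) * (2 * \<beta> + 1))"

definition smoothness_class ::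
  "(int \<Rightarrow> int set) \<Rightarrow> (int \<Rightarrow> int \<Rightarrow> real \<Rightarrow> real) \<Rightarrow> real \<Rightarrow> real \<Rightarrow> (real \<Rightarrow> real) set" where
  "smoothness_class I \<Psi> \<beta> Q =
     {f \<in> L2_unit. has_wavelet_expansion I \<Psi> f (wavelet_coeff \<Psi> f)
        \<and> (\<forall>j\<ge>-1. \<forall>k\<in>I j. \<bar>wavelet_coeff \<Psi> f j k\<bar> \<le> Q * coeff_bound \<beta> j)}"


section \<open>The white noise model\<close>

definition brownian_motion :: "'a measure \<Rightarrow> (real \<Rightarrow> 'a \<Rightarrow> real) \<Rightarrow> bool" where
  "brownian_motion M W \<longleftrightarrow>
     prob_space M
   \<and> (\<forall>t\<in>{0..1}. W t \<in> borel_measurable M)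
   \<and> (AE \<omega> in M. W 0 \<omega> = 0)
   \<and> (\<forall>r t. 0 \<le> r \<longrightarrow> r < t \<longrightarrow> t \<le> 1 \<longrightarrow>
        distributed M lborel (\<lambda>\<omega>. W t \<omega> - W r \<omega>) (normal_density 0 (sqrt (t - r))))
   \<and> (\<forall>p (\<tau>::nat \<Rightarrow> real). mono_on {..p} \<tau> \<longrightarrow> \<tau> ` {..p} \<subseteq> {0..1} \<longrightarrow>
        prob_space.indep_vars M (\<lambda>_. borel) (\<lambda>i \<omega>. W (\<tau> (Suc i)) \<omega> - W (\<tau> i) \<omega>) {..<p})
   \<and> (AE \<omega> in M. continuous_on {0..1} (\<lambda>t. W t \<omega>))"

definition observed_process ::
  "(real \<Rightarrow> 'a \<Rightarrow> real) \<Rightarrow> nat \<Rightarrow> (real \<Rightarrow> real) \<Rightarrow> real \<Rightarrow> 'a \<Rightarrow> real" where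
  "observed_process W n f t \<omega> = (\<integral>u. f u \<partial>lebesgue_on {0..t}) + W t \<omega> / sqrt (real n)"

text \<open>
  The stochastic integral over the unit interval of a deterministic square integrable \<open>h\<close>, as the
  mean-square limit of integrals of step functions. For Brownian motion with a square integrable
  drift it exists and is almost surely unique.
\<close>

definition has_stochastic_integral ::
  "'a measure \<Rightarrow> (real \<Rightarrow> 'a \<Rightarrow> real) \<Rightarrow> (real \<Rightarrow> real) \<Rightarrow> ('a \<Rightarrow> real) \<Rightarrow> bool" where
  "has_stochastic_integral M Y h X \<longleftrightarrow>
     X \<in> borel_measurable M
   \<and> (\<forall>e>0. \<exists>p (\<tau>::nat \<Rightarrow> real) (c::nat \<Rightarrow> real).
        mono_on {..p} \<tau> \<and> \<tau> ` {..p} \<subseteq> {0..1}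
      \<and> (\<integral>\<^sup>+x. ennreal ((h x - (\<Sum>i<p. c i * indicator {\<tau> i<..\<tau> (Suc i)} x))\<^sup>2)
            \<partial>lebesgue_on {0..1}) < ennreal e
      \<and> (\<integral>\<^sup>+\<omega>. ennreal ((X \<omega> - (\<Sum>i<p. c i * (Y (\<tau> (Suc i)) \<omega> - Y (\<tau> i) \<omega>)))\<^sup>2) \<partial>M)
          < ennreal e)"

definition stochastic_integral ::
  "'a measure \<Rightarrow> (real \<Rightarrow> 'a \<Rightarrow> real) \<Rightarrow> (real \<Rightarrow> real) \<Rightarrow> 'a \<Rightarrow> real" where
  "stochastic_integral M Y h = (SOME X. has_stochastic_integral M Y h X)"

text \<open>The array of all empirical wavelet coefficients at noise level \<open>1 / sqrt n\<close>.\<close>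

definition empirical_coeffs ::
  "'a measure \<Rightarrow> (real \<Rightarrow> 'a \<Rightarrow> real) \<Rightarrow> (int \<Rightarrow> int set) \<Rightarrow> (int \<Rightarrow> int \<Rightarrow> real \<Rightarrow> real)
     \<Rightarrow> nat \<Rightarrow> (real \<Rightarrow> real) \<Rightarrow> 'a \<Rightarrow> int \<times> int \<Rightarrow> real" where
  "empirical_coeffs M W I \<Psi> n f \<omega> =
     (\<lambda>(j, k)\<in>wavelet_index I. stochastic_integral M (observed_process W n f) (\<Psi> j k) \<omega>)"

text \<open>
  A data-driven procedure: for every sample size \<open>n\<close> and every level \<open>j\<close> a measurable function
  of the array of empirical coefficients.
\<close>

definition data_driven ::
  "(int \<Rightarrow> int set) \<Rightarrow> (nat \<Rightarrow> int) \<Rightarrow> (nat \<Rightarrow> int \<Rightarrow> (int \<times> int \<Rightarrow> real) \<Rightarrow> real) \<Rightarrow> bool" where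
  "data_driven I J t \<longleftrightarrow>
     (\<forall>n. \<forall>j\<in>{-1..J n}. t n j \<in> borel_measurable (\<Pi>\<^sub>M p\<in>wavelet_index I. borel))"

end

theory Submission
  imports Defs
begin

text \<open>
  The zero function lies in both classes, and its data have the same law whichever smoothness is
  deemed true. On the top level \<open>J n\<close>, which tends to infinity, the two bands prescribed for the
  procedure are eventually disjoint, so the two success events are disjoint under the zero function
  and cannot both have probability tending to one.
\<close>

lemma zero_in_smoothness_class:
  assumes "Q \<ge> 0"
  shows "(\<lambda>_. 0) \<in> smoothness_class I \<Psi> \<beta> Q"
  using assms
  by (simp add: smoothness_class_def L2_unit_def has_wavelet_expansion_def wavelet_coeff_def
      inner_unit_def coeff_bound_def)

lemma coeff_bound_pos: "coeff_bound \<beta> j > 0"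
  by (simp add: coeff_bound_def)

text \<open>Isolates the ratio of the two bounds as a power of \<open>2 powr j\<close>, the quantity
  whose growth is known along \<open>J n\<close>. For \<beta> < \<beta>' the exponent is
  negative.\<close>

lemma coeff_bound_eq_mult_powr:
  "coeff_bound \<beta>' j = coeff_bound \<beta> j * (2 powr real_of_int j) powr (- (\<beta>' - \<beta>))"
proof -
  have "- (real_of_int j / 2) * (2 * \<beta>' + 1)
      = - (real_of_int j / 2) * (2 * \<beta> + 1) + real_of_int j * (- (\<beta>' - \<beta>))"
    by (simp add: field_simps)
  then show ?thesis
    by (simp only: coeff_bound_def powr_powr powr_add)
qed

text \<open>The ratio of the bounds at level \<open>J n\<close> is a negative power of a sequence
  tending to infinity, hence vanishes. No fixed constant \<open>Q'\<close>, however large, can make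
  up for it.\<close>

lemma eventually_coeff_bound_less:
  fixes J :: "nat \<Rightarrow> int"
  assumes J: "filterlim (\<lambda>n. 2 powr real_of_int (J n)) at_top sequentially"
    and "\<beta> < \<beta>'" and "Q > 0"
  shows "eventually (\<lambda>n. Q' * coeff_bound \<beta>' (J n) < Q * coeff_bound \<beta> (J n)) sequentially"
proof -
  have "(\<lambda>n. (2 powr real_of_int (J n)) powr (- (\<beta>' - \<beta>))) \<longlonglongrightarrow> 0"
    using assms by (intro tendsto_neg_powr) auto
  then have "(\<lambda>n. Q' * (2 powr real_of_int (J n)) powr (- (\<beta>' - \<beta>))) \<longlonglongrightarrow> 0"
    by (rule tendsto_mult_right_zero)
  then have "eventually (\<lambda>n. Q' * (2 powr real_of_int (J n)) powr (- (\<beta>' - \<beta>)) < Q) sequentially"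
    using \<open>Q > 0\<close> by (rule order_tendstoD)
  then show ?thesis
  proof eventually_elim
    case (elim n)
    then show ?case
      using mult_strict_left_mono [OF elim coeff_bound_pos [of \<beta> "J n"]]
      by (simp add: coeff_bound_eq_mult_powr [of \<beta>' _ \<beta>] mult_ac)
  qed
qed

text \<open>The lower half of the two-sided bound puts a positive multiple of \<open>n\<close> below
  the norm of \<open>f n\<close>, and nonnegativity removes the norm.\<close>

lemma filterlim_at_top_of_bigtheta_real:
  fixes f :: "nat \<Rightarrow> real"
  assumes "f \<in> \<Theta>(\<lambda>n. real n)" and nonneg: "\<And>n. f n \<ge> 0"
  shows "filterlim f at_top sequentially"
proof -
  have "f \<in> \<Omega>(\<lambda>n. real n)"
    using assms(1) by (simp add: bigthetaD2)
  then obtain c where c: "c > 0" and "eventually (\<lambda>n. norm (f n) \<ge> c * norm (real n)) sequentially"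
    by (rule landau_omega.bigE)
  then have "eventually (\<lambda>n. c * real n \<le> f n) sequentially"
    using nonneg by simp
  moreover have "filterlim (\<lambda>n. c * real n) at_top sequentially"
    by (rule filterlim_tendsto_pos_mult_at_top [OF tendsto_const c filterlim_real_sequentially])
  ultimately show ?thesis
    by (rule filterlim_at_top_mono [rotated])
qed

text \<open>No measurability is assumed: a non-measurable set has \<open>measure\<close> zero.\<close>

lemma (in prob_space) not_tendsto_one_of_disjoint:
  assumes "A \<longlonglongrightarrow> 1" and "B \<longlonglongrightarrow> 1"
    and le: "\<And>n. A n \<le> prob (E n)" "\<And>n. B n \<le> prob (F n)"
    and disj: "eventually (\<lambda>n. E n \<inter> F n = {}) sequentially"
  shows False
proof -
  \<comment> \<open>With 1/2 as threshold, the union of two disjoint events would get probability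
    above 1.\<close>
  have "eventually (\<lambda>n. A n > 1 / 2) sequentially" "eventually (\<lambda>n. B n > 1 / 2) sequentially"
    by (rule order_tendstoD(1) [OF assms(1)], simp) (rule order_tendstoD(1) [OF assms(2)], simp)
  with disj have "eventually (\<lambda>n. False) sequentially"
  proof eventually_elim
    case (elim n)
    have "prob (E n) > 1 / 2" "prob (F n) > 1 / 2"
      using elim le [of n] by linarith+
    moreover from this have "E n \<in> events" "F n \<in> events"
      by (auto intro: ccontr simp: measure_notin_sets)
    ultimately show False
      using finite_measure_Union [of "E n" "F n"] elim(1) prob_le_1 [of "E n \<union> F n"] by simp
  qed
  then show False
    by simp
qed

theorem theorem2:
  fixes \<phi> \<psi> :: "real \<Rightarrow> real" and s :: nat
    and I :: "int \<Rightarrow> int set" and \<Psi> :: "int \<Rightarrow> int \<Rightarrow> real \<Rightarrow> real"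
    and M :: "'a measure" and W :: "real \<Rightarrow> 'a \<Rightarrow> real"
    and \<beta>\<^sub>1 \<beta>\<^sub>2 Q :: real and J :: "nat \<Rightarrow> int"
  assumes "cdv_wavelet_basis s \<phi> \<psi> I \<Psi>"
    and "brownian_motion M W"
    and "\<beta>\<^sub>1 \<noteq> \<beta>\<^sub>2" and "\<beta>\<^sub>1 > 1 / 2" and "\<beta>\<^sub>2 > 1 / 2" and "Q > 0"
    and "(\<lambda>n. 2 powr real_of_int (J n)) \<in> \<Theta>(\<lambda>n. real n)"
  shows "\<not> (\<exists>t. data_driven I J t \<and>
           (\<exists>Q'::real. \<forall>\<beta>\<in>{\<beta>\<^sub>1, \<beta>\<^sub>2}.
              (\<lambda>n. INF f\<in>smoothness_class I \<Psi> \<beta> Q.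
                 measure M {\<omega> \<in> space M. \<forall>j\<in>{-1..J n}.
                   Q * coeff_bound \<beta> j \<le> t n j (empirical_coeffs M W I \<Psi> n f \<omega>) \<and>
                   t n j (empirical_coeffs M W I \<Psi> n f \<omega>) \<le> Q' * coeff_bound \<beta> j})
              \<longlonglongrightarrow> 1))"
proof
  define S where "S t n \<beta> Q' f = {\<omega> \<in> space M. \<forall>j\<in>{-1..J n}.
      Q * coeff_bound \<beta> j \<le> t n j (empirical_coeffs M W I \<Psi> n f \<omega>) \<and>
      t n j (empirical_coeffs M W I \<Psi> n f \<omega>) \<le> Q' * coeff_bound \<beta> j}"
    for t :: "nat \<Rightarrow> int \<Rightarrow> (int \<times> int \<Rightarrow> real) \<Rightarrow> real" and n \<beta> Q' f
  define R where "R t n \<beta> Q' = (INF f\<in>smoothness_class I \<Psi> \<beta> Q. measure M (S t n \<beta> Q' f))"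
    for t n \<beta> Q'
  interpret prob_space M
    using assms(2) by (simp add: brownian_motion_def)
  assume "\<exists>t. data_driven I J t \<and>
           (\<exists>Q'::real. \<forall>\<beta>\<in>{\<beta>\<^sub>1, \<beta>\<^sub>2}.
              (\<lambda>n. INF f\<in>smoothness_class I \<Psi> \<beta> Q.
                 measure M {\<omega> \<in> space M. \<forall>j\<in>{-1..J n}.
                   Q * coeff_bound \<beta> j \<le> t n j (empirical_coeffs M W I \<Psi> n f \<omega>) \<and>
                   t n j (empirical_coeffs M W I \<Psi> n f \<omega>) \<le> Q' * coeff_bound \<beta> j})
              \<longlonglongrightarrow> 1)"
  then obtain t Q' where lim: "\<And>\<beta>. \<beta> \<in> {\<beta>\<^sub>1, \<beta>\<^sub>2} \<Longrightarrow> (\<lambda>n. R t n \<beta> Q') \<longlonglongrightarrow> 1"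
    unfolding R_def S_def by blast
  \<comment> \<open>An infimum of reals lies below its members only if the family is bounded below;
    probabilities are bounded by 0.\<close>
  have R_le: "R t n \<beta> Q' \<le> measure M (S t n \<beta> Q' (\<lambda>_. 0))" for n \<beta>
    unfolding R_def using \<open>Q > 0\<close>
    by (intro cINF_lower bdd_belowI2 [where m = 0] zero_in_smoothness_class) auto
  have J: "filterlim (\<lambda>n. 2 powr real_of_int (J n)) at_top sequentially"
    using assms(7) by (rule filterlim_at_top_of_bigtheta_real) simp
  \<comment> \<open>Level -1 is the coarsest one; once \<open>J n\<close> reaches it,
    \<open>J n\<close> itself is among the levels that \<open>S\<close> constrains.\<close>
  then have "eventually (\<lambda>n. 2 powr real_of_int (J n) \<ge> 2 powr (-1)) sequentially"
    unfolding filterlim_at_top by blast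
  then have J_ge: "eventually (\<lambda>n. J n \<ge> -1) sequentially"
    by (rule eventually_mono) (subst (asm) powr_le_cancel_iff, simp_all)
  \<comment> \<open>Stated for an ordered pair, so that either order of
    \<open>\<beta>\<^sub>1\<close> and \<open>\<beta>\<^sub>2\<close> is covered.\<close>
  have False if less: "\<beta> < \<beta>'" and mem: "\<beta> \<in> {\<beta>\<^sub>1, \<beta>\<^sub>2}" "\<beta>' \<in> {\<beta>\<^sub>1, \<beta>\<^sub>2}" for \<beta> \<beta>'
  proof (rule not_tendsto_one_of_disjoint [OF lim [OF mem(1)] lim [OF mem(2)] R_le R_le])
    show "eventually (\<lambda>n. S t n \<beta> Q' (\<lambda>_. 0) \<inter> S t n \<beta>' Q' (\<lambda>_. 0) = {}) sequentially"
      using eventually_coeff_bound_less [OF J less \<open>Q > 0\<close>, of Q'] J_ge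
    proof eventually_elim
      case (elim n)
      then have "J n \<in> {-1..J n}"
        by simp
      \<comment> \<open>Both events constrain the same value of \<open>t\<close> at level
        \<open>J n\<close>, since the data do not involve \<beta>. It would be at least
        \<open>Q * coeff_bound \<beta> (J n)\<close> and at most the strictly smaller
        \<open>Q' * coeff_bound \<beta>' (J n)\<close>.\<close>
      with elim(1) show ?case
        unfolding S_def by fastforce
    qed
  qed
  with \<open>\<beta>\<^sub>1 \<noteq> \<beta>\<^sub>2\<close> show False
    by (metis insertI1 insertI2 linorder_neqE_linordered_idom)
qed

end
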